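(* Let $K$ be a zero-dimensional compact Hausdorff space whose set of isolated points is dense in $K$, and such that the set $K'$ of accumulation points of $K$ is a $G_\delta$ subset of $K$. Let $F:B_{C(K)}\to B_{C(K)}$ be a non-expansive bijection. Then $F$ is an isometry under either of the following additional assumptions: (i) $F$ has property $( * )$: for any $u,v,z\in K$ with $u\neq v$ and any sign $\omega\in\{-1,1\}$, there exists $f\in B_{C(K)}$ such that $f(u)f(v)$ is non-zero with sign $\omega$ and $|F(f)|\equiv 1$ on some neighbourhood of $z$; (ii) $\inf\{\|F(\omega\mathds{1}_{\{a\}})\| : a\in K\setminus K',\ \omega=\pm1\}>1/2$.
   Context: $C(K)$ is the Banach space of real-valued continuous functions on $K$ with the supremum norm and $B_{C(K)}$ its closed unit ball. A topological space is zero-dimensional if it has a basis of clopen sets. A map is non-expansive if it is $1$-Lipschitz. $\mathds{1}_{\{a\}}$ is the indicator function of $\{a\}$ (continuous when $a$ is isolated). *)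

theory Defs
  imports "HOL-Analysis.Analysis"
begin

definition zero_dimensional_space :: "'a::topological_space itself \<Rightarrow> bool" where
  "zero_dimensional_space _ \<longleftrightarrow>
     (\<forall>U x. open (U::'a set) \<and> x \<in> U \<longrightarrow> (\<exists>V. open V \<and> closed V \<and> x \<in> V \<and> V \<subseteq> U))"

text \<open>Closed unit ball of C(K), realised as bounded continuous functions (K compact).\<close>
abbreviation unit_ball_CK :: "('a::topological_space \<Rightarrow>\<^sub>C real) set" where
  "unit_ball_CK \<equiv> cball 0 1"

definition property_star :: "(('a::topological_space \<Rightarrow>\<^sub>C real) \<Rightarrow> ('a \<Rightarrow>\<^sub>C real)) \<Rightarrow> bool" where
  "property_star F \<longleftrightarrow>
     (\<forall>u v z (\<omega>::real). u \<noteq> v \<and> \<omega> \<in> {-1, 1} \<longrightarrow>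
        (\<exists>f \<in> unit_ball_CK.
            apply_bcontfun f u * apply_bcontfun f v \<noteq> 0 \<and>
            sgn (apply_bcontfun f u * apply_bcontfun f v) = \<omega> \<and>
            (\<exists>W. open W \<and> z \<in> W \<and> (\<forall>x\<in>W. \<bar>apply_bcontfun (F f) x\<bar> = 1))))"

end

theory Submission
  imports Defs
begin

text \<open>
  Write \<open>G\<close> for the inverse of \<open>F\<close>, \<open>I\<close> for the set of isolated points and \<open>K' = K - I\<close>.
  Functions of constant modulus 1 are the extreme points of the ball, and \<open>G\<close> maps them to
  functions of constant modulus 1. Testing \<open>F (\<plusminus>1\<^bsub>{a}\<^esub>)\<close> against them shows that it is supported at one
  isolated point \<open>\<sigma> a\<close>, and that \<open>G e = \<epsilon> \<cdot> (e \<circ> \<sigma>)\<close> on \<open>I\<close> for all such \<open>e\<close>; by compactness and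
  density \<open>\<sigma>\<close> extends to a continuous surjection of \<open>K\<close>. Either additional assumption makes \<open>\<sigma>\<close>
  injective, hence a homeomorphism, and after composing with \<open>h \<mapsto> \<epsilon> \<cdot> (h \<circ> \<sigma>)\<close> one may assume that
  \<open>F\<close> fixes all functions of constant modulus 1.

  Then \<open>\<bar>F f\<bar> \<le> \<bar>f\<bar>\<close> with the same sign, so \<open>\<bar>G\<^sup>n g\<bar>\<close> is pointwise increasing. If these iterates only
  move on a finite set, consecutive ones become arbitrarily close; as \<open>G\<close> is expanding, \<open>G g = g\<close>.
  This yields fixed points with \<open>\<bar>g\<bar> = 1\<close> off a finite set, then, through non-expansiveness, fixed
  points with \<open>\<bar>g\<bar> = 1/2\<close> on \<open>K'\<close> and \<open>\<bar>g\<bar> < 1/2\<close> on \<open>I\<close> up to a finite set (such \<open>g\<close> exist because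
  \<open>K'\<close> is a \<open>G\<^sub>\<delta>\<close>). These give \<open>\<bar>F f\<bar> \<ge> min \<bar>f\<bar> M\<close> for \<open>M = 1/2\<close>, and \<open>M\<close> improves to \<open>(1 + M)/2\<close> by
  approximating \<open>f\<close> by fixed points with values in \<open>\<bar>t\<bar> < M\<close> or \<open>\<bar>t\<bar> = 1\<close>.
\<close>

section \<open>Functions on zero-dimensional compact spaces\<close>

text \<open>The unit ball of \<open>C(K)\<close> as plain functions, so that single values can be
  changed by \<open>fun_upd\<close>.\<close>

definition unit_functions :: "('a::topological_space \<Rightarrow> real) set" where
  "unit_functions = {f. continuous_on UNIV f \<and> (\<forall>x. \<bar>f x\<bar> \<le> 1)}"

definition sign_functions :: "('a::topological_space \<Rightarrow> real) set" where
  "sign_functions = {e. continuous_on UNIV e \<and> (\<forall>x. \<bar>e x\<bar> = 1)}"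

definition isolated_points :: "'a::topological_space set" where
  "isolated_points = {x. open {x}}"

lemma sign_functions_subset: "sign_functions \<subseteq> unit_functions"
  by (auto simp: sign_functions_def unit_functions_def)

lemma sign_function_cases:
  assumes "e \<in> sign_functions"
  shows "e x = 1 \<or> e x = - 1"
proof -
  have "\<bar>e x\<bar> = 1" using assms by (simp add: sign_functions_def)
  then show ?thesis by linarith
qed

lemma continuous_on_if_clopen:
  fixes f g :: "'a::topological_space \<Rightarrow> 'b::topological_space"
  assumes "open D" "closed D" "continuous_on D f" "continuous_on (-D) g"
  shows "continuous_on UNIV (\<lambda>x. if x \<in> D then f x else g x)"
proof -
  have "continuous_on (D \<union> - D) (\<lambda>x. if x \<in> D then f x else g x)"
    using assms by (intro continuous_on_If) auto
  then show ?thesis by simp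
qed

lemma sign_function_of_clopen:
  assumes "open D" "closed D"
  shows "(\<lambda>x. if x \<in> D then 1 else - 1) \<in> sign_functions"
  unfolding sign_functions_def
  using continuous_on_if_clopen[OF assms, of "\<lambda>_. 1 :: real" "\<lambda>_. - 1"] by auto

lemma fun_upd_isolated_continuous:
  fixes f :: "'a::t2_space \<Rightarrow> 'b::topological_space"
  assumes "a \<in> isolated_points" "continuous_on UNIV f"
  shows "continuous_on UNIV (f(a := t))"
proof -
  have "continuous_on UNIV (\<lambda>x. if x \<in> {a} then t else f x)"
    using assms by (intro continuous_on_if_clopen)
      (auto simp: isolated_points_def intro: continuous_on_subset)
  then show ?thesis by (simp add: fun_upd_def)
qed

lemma fun_upd_unit_functions:
  fixes f :: "'a::t2_space \<Rightarrow> real"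
  assumes "a \<in> isolated_points" "f \<in> unit_functions" "\<bar>t\<bar> \<le> 1"
  shows "f(a := t) \<in> unit_functions"
  using assms fun_upd_isolated_continuous[of a f t] by (auto simp: unit_functions_def)

lemma clopen_level_set_sign:
  assumes "e \<in> sign_functions"
  shows "open {x. e x = c}" "closed {x. e x = c}"
proof -
  have ce: "continuous_on UNIV e" using assms by (simp add: sign_functions_def)
  show "closed {x. e x = c}"
    using ce by (intro closed_Collect_eq) auto
  note dich = sign_function_cases[OF assms]
  have pos: "{x. e x = 1} = {x. 0 < e x}" and neg: "{x. e x = -1} = {x. e x < 0}"
    using dich by (force, smt (verit) Collect_cong)
  have "open {x. 0 < e x}" "open {x. e x < 0}"
    using ce by (auto intro!: open_Collect_less)
  moreover have "{x. e x = c} = {}" if "c \<noteq> 1" "c \<noteq> -1"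
    using dich that by (auto; metis)
  ultimately show "open {x. e x = c}"
    using pos neg by (cases "c = 1"; cases "c = -1") auto
qed

section \<open>Clopen sets and density of the isolated points\<close>

locale zero_dim_compactum =
  fixes T :: "'a::t2_space itself"
  assumes compact_UNIV: "compact (UNIV :: 'a set)"
    and clopen_base: "\<And>U (x::'a). open U \<Longrightarrow> x \<in> U \<Longrightarrow> \<exists>V. open V \<and> closed V \<and> x \<in> V \<and> V \<subseteq> U"
    and isolated_dense: "closure (isolated_points :: 'a set) = UNIV"
begin

text \<open>Density in use: closed conditions need only be checked at isolated points, where
  functions can be altered one value at a time.\<close>

lemma closed_isolated_UNIV:
  assumes "closed {x::'a. P x}" "\<And>a. a \<in> isolated_points \<Longrightarrow> P a"
  shows "P x"
proof -
  have "closure isolated_points \<subseteq> {x. P x}"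
    using assms by (intro closure_minimal) auto
  then show ?thesis using isolated_dense by auto
qed

lemma open_meets_isolated:
  assumes "open W" "(x::'a) \<in> W"
  shows "\<exists>a\<in>isolated_points. a \<in> W"
  using assms isolated_dense open_Int_closure_eq_empty[of W isolated_points] by blast

lemma compact_if_closed: "closed (C :: 'a set) \<Longrightarrow> compact C"
  using closed_Int_compact[OF _ compact_UNIV] by auto

text \<open>The singletons form an open cover of the compact set \<open>C\<close>.\<close>

lemma finite_closed_isolated:
  assumes "closed (C :: 'a set)" "C \<subseteq> isolated_points"
  shows "finite C"
proof -
  have "\<exists>D\<subseteq>C. finite D \<and> C \<subseteq> (\<Union>x\<in>D. {x})"
    by (rule compactE_image[OF compact_if_closed[OF assms(1)], of C "\<lambda>x. {x}"])
       (use assms(2) in \<open>auto simp: isolated_points_def\<close>)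
  then show ?thesis by (metis UN_singleton finite_subset)
qed

text \<open>Clopen neighbourhoods inside \<open>W\<close> cover the compact set \<open>C\<close>,
  and a finite union of them is clopen.\<close>

lemma clopen_between:
  assumes "closed (C :: 'a set)" "open W" "C \<subseteq> W"
  obtains D where "open D" "closed D" "C \<subseteq> D" "D \<subseteq> W"
proof -
  define \<V> where "\<V> = {V. open V \<and> closed V \<and> V \<subseteq> W}"
  have "C \<subseteq> \<Union>\<V>"
  proof
    fix x assume "x \<in> C"
    then obtain V where "open V" "closed V" "x \<in> V" "V \<subseteq> W"
      using clopen_base[of W x] assms by blast
    then show "x \<in> \<Union>\<V>" by (auto simp: \<V>_def)
  qed
  moreover have "\<And>B. B \<in> \<V> \<Longrightarrow> open B" by (simp add: \<V>_def)
  ultimately obtain \<D> where "\<D> \<subseteq> \<V>" "finite \<D>" "C \<subseteq> \<Union>\<D>"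
    by (rule compactE[OF compact_if_closed[OF assms(1)]])
  then show ?thesis
    by (intro that[of "\<Union>\<D>"]) (auto simp: \<V>_def intro!: closed_Union)
qed

lemma clopen_separation:
  assumes "(u::'a) \<noteq> v"
  obtains D where "open D" "closed D" "u \<in> D" "v \<notin> D"
  using clopen_base[of "- {v}" u] assms by auto

lemma sign_separation:
  assumes "(u::'a) \<noteq> v"
  obtains e where "e \<in> sign_functions" "e u = 1" "e v = -1"
proof -
  obtain D where D: "open D" "closed D" "u \<in> D" "v \<notin> D"
    using clopen_separation[OF assms] .
  show ?thesis
    by (rule that[OF sign_function_of_clopen[OF D(1,2)]]) (use D in auto)
qed

text \<open>The sign of \<open>f\<close> may jump at zeros; the clopen \<open>D\<close> supplies a
  continuous substitute, wrong only where \<open>\<bar>f\<bar>\<close> is below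
  \<open>\<eta>\<close>.\<close>

lemma approx_sign:
  fixes f :: "'a \<Rightarrow> real"
  assumes "continuous_on UNIV f" "0 < \<eta>"
  obtains D where "open D" "closed D" "\<And>x. 0 \<le> f x \<Longrightarrow> x \<in> D" "\<And>x. x \<in> D \<Longrightarrow> - \<eta> < f x"
proof -
  have "closed {x. 0 \<le> f x}" "open {x. - \<eta> < f x}"
    using assms by (auto intro!: closed_Collect_le open_Collect_less)
  moreover have "{x. 0 \<le> f x} \<subseteq> {x. - \<eta> < f x}" using assms by auto
  ultimately obtain D where "open D" "closed D" "{x. 0 \<le> f x} \<subseteq> D" "D \<subseteq> {x. - \<eta> < f x}"
    using clopen_between by blast
  then show ?thesis by (intro that) auto
qed

end

text \<open>The last assumption is the 1-Lipschitz condition for the supremum norm, with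
  \<open>d\<close> any uniform bound, so that no norm on plain functions is needed.\<close>

locale nonexpansive_ball_bijection = zero_dim_compactum T
  for T :: "'a::t2_space itself" +
  fixes F :: "('a \<Rightarrow> real) \<Rightarrow> 'a \<Rightarrow> real"
  assumes bij: "bij_betw F unit_functions unit_functions"
    and nonexpansive: "\<And>f g d x. f \<in> unit_functions \<Longrightarrow> g \<in> unit_functions \<Longrightarrow>
      (\<And>y. \<bar>f y - g y\<bar> \<le> d) \<Longrightarrow> \<bar>F f x - F g x\<bar> \<le> d"
begin

definition G :: "('a \<Rightarrow> real) \<Rightarrow> 'a \<Rightarrow> real" where
  "G = inv_into unit_functions F"

lemma F_in: "f \<in> unit_functions \<Longrightarrow> F f \<in> unit_functions"
  using bij by (auto simp: bij_betw_def)

lemma G_in: "f \<in> unit_functions \<Longrightarrow> G f \<in> unit_functions"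
  using bij by (metis G_def bij_betw_imp_surj_on inv_into_into)

lemma F_G: "f \<in> unit_functions \<Longrightarrow> F (G f) = f"
  using bij by (metis G_def bij_betw_inv_into_right)

lemma G_F: "f \<in> unit_functions \<Longrightarrow> G (F f) = f"
  using bij by (metis G_def bij_betw_inv_into_left)

end

section \<open>Bijections fixing the functions of constant modulus 1\<close>

locale sign_fixing_bijection = nonexpansive_ball_bijection T F
  for T :: "'a::t2_space itself" and F +
  assumes fixes_signs: "e \<in> sign_functions \<Longrightarrow> F e = e"
begin

text \<open>As \<open>\<bar>f\<bar> \<le> 1\<close>, the hypothesis puts \<open>f\<close> within
  \<open>1 + c\<close> of \<open>e\<close>; \<open>F\<close> fixes \<open>e\<close> and does not
  increase this distance.\<close>

lemma product_lower_bound: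
  assumes f: "f \<in> unit_functions" and e: "e \<in> sign_functions"
    and c: "\<And>x. - c \<le> f x * e x"
  shows "- c \<le> F f x * e x"
proof -
  note e1 = sign_function_cases[OF e]
  have "\<bar>f y - e y\<bar> \<le> 1 + c" for y
  proof -
    have "\<bar>f y\<bar> \<le> 1" using f by (simp add: unit_functions_def)
    then show ?thesis using e1[of y] c[of y] by auto
  qed
  then have "\<bar>F f x - F e x\<bar> \<le> 1 + c"
    using nonexpansive f e sign_functions_subset by blast
  then show ?thesis using e1[of x] fixes_signs[OF e] by auto
qed

text \<open>Reversing \<open>e\<close> at the isolated point \<open>a\<close> keeps it continuous,
  and the lower bound for the reversed function is an upper bound for \<open>e\<close> at
  \<open>a\<close>.\<close>

lemma flip_upper_bound:
  assumes f: "f \<in> unit_functions" and e: "e \<in> sign_functions" and a: "a \<in> isolated_points"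
    and c: "\<And>x. - c \<le> f x * e x" and fa: "\<bar>f a\<bar> \<le> c"
  shows "F f a * e a \<le> c"
proof -
  have a1: "\<bar>e a\<bar> = 1" using e by (simp add: sign_functions_def)
  have e': "e(a := - e a) \<in> sign_functions"
    using e a fun_upd_isolated_continuous[of a e "- e a"] by (auto simp: sign_functions_def)
  have "- c \<le> f x * (e(a := - e a)) x" for x
  proof (cases "x = a")
    case True
    have "\<bar>f a * e a\<bar> \<le> c" using a1 fa by (simp add: abs_mult)
    then show ?thesis using True by simp
  qed (use c in auto)
  from product_lower_bound[OF f e' this, of a] show ?thesis by simp
qed

text \<open>Let \<open>e\<close> be an approximate sign of \<open>f\<close>: the lower bound
  controls the sign of \<open>F f a\<close>, the flipped bound its modulus.\<close>

lemma isolated_sign_and_modulus: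
  assumes f: "f \<in> unit_functions" and a: "a \<in> isolated_points"
  shows "\<bar>F f a\<bar> \<le> \<bar>f a\<bar> \<and> 0 \<le> F f a * f a"
proof -
  \<comment> \<open>For \<open>f a < 0\<close> the condition \<open>small\<close> keeps
    \<open>a\<close> outside the clopen set, so that \<open>e a = s\<close>.\<close>
  have key: "- \<eta> \<le> F f a * s \<and> F f a * s \<le> max \<eta> \<bar>f a\<bar>"
    if "0 < \<eta>" and s: "s = (if 0 \<le> f a then 1 else -1)" and small: "f a < 0 \<Longrightarrow> \<eta> < - f a" for \<eta> s
  proof -
    obtain D where D: "open D" "closed D" "\<And>x. 0 \<le> f x \<Longrightarrow> x \<in> D" "\<And>x. x \<in> D \<Longrightarrow> - \<eta> < f x"
      using approx_sign[of f \<eta>] f \<open>0 < \<eta>\<close> by (auto simp: unit_functions_def)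
    define e :: "'a \<Rightarrow> real" where "e x = (if x \<in> D then 1 else - 1)" for x
    have e: "e \<in> sign_functions" using sign_function_of_clopen[OF D(1,2)] by (simp add: e_def[abs_def])
    have ea: "e a = s"
      using s D(3)[of a] D(4)[of a] small by (cases "0 \<le> f a") (auto simp: e_def)
    have fe: "- \<eta> \<le> f x * e x" for x 
      using D(3)[of x] D(4)[of x] \<open>0 < \<eta>\<close> by (cases "0 \<le> f x") (auto simp: e_def)
    have fe': "- max \<eta> \<bar>f a\<bar> \<le> f x * e x" for x
      using fe[of x] by linarith
    show ?thesis
      using product_lower_bound[OF f e fe, of a] flip_upper_bound[OF f e a fe'] ea by simp
  qed
  show ?thesis
  proof (cases "0 \<le> f a")
    case True
    have k: "- F f a \<le> 0 + \<eta>" "F f a \<le> f a + \<eta>" if "0 < \<eta>" for \<eta>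
      using key[OF that refl] True that by auto
    have "- F f a \<le> 0" using k(1) by (rule field_le_epsilon)
    moreover have "F f a \<le> f a" using k(2) by (rule field_le_epsilon)
    ultimately show ?thesis using True by simp
  next
    case False
    have k: "- \<eta> \<le> - F f a \<and> - F f a \<le> \<bar>f a\<bar>" if "0 < \<eta>" "\<eta> < - f a" for \<eta>
      using key[OF that(1) refl] False that by auto
    have "- F f a \<le> \<bar>f a\<bar>" using k[of "- f a / 2"] False by auto
    moreover have "F f a \<le> 0"
    proof (rule ccontr)
      assume "\<not> F f a \<le> 0"
      \<comment> \<open>The error must be below \<open>- f a\<close> to be admissible and below
        \<open>F f a\<close> to contradict \<open>F f a \<le> \<eta>\<close>.\<close>
      then show False
        using k[of "min (F f a / 2) (- f a / 2)"] False by (cases "F f a \<le> - f a") (auto simp: min_def)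
    qed
    ultimately show ?thesis using False by (simp add: mult_nonpos_nonpos)
  qed
qed

lemma sign_and_modulus:
  assumes f: "f \<in> unit_functions"
  shows "\<bar>F f x\<bar> \<le> \<bar>f x\<bar>" "0 \<le> F f x * f x"
proof -
  have c: "continuous_on UNIV f" "continuous_on UNIV (F f)"
    using f F_in[OF f] by (auto simp: unit_functions_def)
  have "closed {x. \<bar>F f x\<bar> \<le> \<bar>f x\<bar>}" "closed {x. 0 \<le> F f x * f x}"
    using c by (auto intro!: closed_Collect_le continuous_intros)
  then show "\<bar>F f x\<bar> \<le> \<bar>f x\<bar>" "0 \<le> F f x * f x"
    using isolated_sign_and_modulus[OF f] by (auto elim!: closed_isolated_UNIV)
qed

section \<open>Growth of moduli under the inverse, and fixed points\<close>

lemma G_sign_and_modulus: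
  assumes g: "g \<in> unit_functions"
  shows "\<bar>g x\<bar> \<le> \<bar>G g x\<bar>" "0 \<le> g x * G g x"
  using sign_and_modulus[OF G_in[OF g], of x] F_G[OF g] by auto

lemma G_eq_if_modulus_le:
  assumes g: "g \<in> unit_functions" and "\<bar>G g x\<bar> \<le> \<bar>g x\<bar>"
  shows "G g x = g x"
proof -
  have "\<bar>g x\<bar> = \<bar>G g x\<bar>" using G_sign_and_modulus(1)[OF g, of x] assms(2) by simp
  then have "G g x = g x \<or> G g x = - g x" by linarith
  then show ?thesis using G_sign_and_modulus(2)[OF g, of x]
    by (auto simp: zero_le_mult_iff)
qed

text \<open>Moduli of the iterates increase with constant sign and are bounded by 1, so increments
  tend to 0 pointwise, uniformly since they vanish off the finite set \<open>A\<close>. The first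
  increment is bounded by every later one.\<close>

lemma fixed_if_iterates_agree:
  assumes g: "g \<in> unit_functions" and A: "finite A"
    and agree: "\<And>n x. x \<notin> A \<Longrightarrow> (G ^^ n) g x = g x"
  shows "F g = g"
proof -
  define h where "h n = (G ^^ n) g" for n
  have hS: "h (Suc n) = G (h n)" for n by (simp add: h_def)
  have h: "h n \<in> unit_functions" for n
    by (induction n) (simp_all add: h_def g G_in)
  have FhS: "F (h (Suc n)) = h n" for n by (simp add: hS F_G h)
  have mono: "\<bar>h n x\<bar> \<le> \<bar>h (Suc n) x\<bar>" for n x
    using G_sign_and_modulus(1)[OF h] by (simp add: hS)
  have increment: "\<bar>h (Suc n) x - h n x\<bar> = \<bar>h (Suc n) x\<bar> - \<bar>h n x\<bar>" for n x
    using mono[of n x] G_sign_and_modulus(2)[OF h, of n x]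
    by (auto simp: hS zero_le_mult_iff abs_if split: if_splits)
  have lim: "(\<lambda>n. \<bar>h (Suc n) x - h n x\<bar>) \<longlonglongrightarrow> 0" for x
  proof -
    have "\<bar>h n x\<bar> \<le> 1" for n using h[of n] by (simp add: unit_functions_def)
    then obtain L where "(\<lambda>n. \<bar>h n x\<bar>) \<longlonglongrightarrow> L"
      using incseq_convergent[OF incseq_SucI, of "\<lambda>n. \<bar>h n x\<bar>" 1] mono by blast
    then have "(\<lambda>n. \<bar>h (Suc n) x\<bar> - \<bar>h n x\<bar>) \<longlonglongrightarrow> L - L"
      by (intro tendsto_diff LIMSEQ_Suc)
    then show ?thesis by (simp add: increment)
  qed
  \<comment> \<open>\<open>F\<close> shifts the sequence back by one index, so a bound on one
    increment passes to the preceding one.\<close>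
  have descend: "\<bar>h 1 x - h 0 x\<bar> \<le> d" if "\<And>y. \<bar>h (Suc n) y - h n y\<bar> \<le> d" for n d x
    using that
  proof (induction n arbitrary: x)
    case (Suc n)
    show ?case
    proof (rule Suc.IH)
      fix y
      show "\<bar>h (Suc n) y - h n y\<bar> \<le> d"
        using nonexpansive[OF h h Suc.prems, of y] by (simp only: FhS)
    qed
  qed simp
  have "\<bar>h 1 x - h 0 x\<bar> \<le> 0 + \<epsilon>" if "0 < \<epsilon>" for x \<epsilon>
  proof -
    have "\<forall>\<^sub>F n in sequentially. \<forall>y\<in>A. \<bar>h (Suc n) y - h n y\<bar> < \<epsilon>"
      using A order_tendstoD(2)[OF lim that] by (intro eventually_ball_finite) auto
    then obtain n where n: "\<forall>y\<in>A. \<bar>h (Suc n) y - h n y\<bar> < \<epsilon>"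
      by (auto simp: eventually_sequentially)
    have "\<bar>h (Suc n) y - h n y\<bar> \<le> \<epsilon>" for y
      using n agree[of y n] agree[of y "Suc n"] that by (cases "y \<in> A") (auto simp: h_def)
    then show ?thesis using descend[of n] by simp
  qed
  then have "\<bar>h 1 x - h 0 x\<bar> \<le> 0" for x by (rule field_le_epsilon)
  then have "G g = g" by (auto simp: h_def)
  then show ?thesis using F_G[OF g] by simp
qed

text \<open>\<open>P\<close> describes the shape of a function off \<open>A\<close>. By
  \<open>step\<close> and \<open>cong\<close> it survives each application of \<open>G\<close>, so
  all iterates agree off \<open>A\<close>.\<close>

lemma fixed_if_invariant:
  assumes g: "g \<in> unit_functions" and A: "finite A" and P: "P g"
    and step: "\<And>h x. h \<in> unit_functions \<Longrightarrow> P h \<Longrightarrow> x \<notin> A \<Longrightarrow> G h x = h x"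
    and cong: "\<And>h h'. P h \<Longrightarrow> (\<And>x. x \<notin> A \<Longrightarrow> h' x = h x) \<Longrightarrow> P h'"
  shows "F g = g"
proof (rule fixed_if_iterates_agree[OF g A])
  have "(G ^^ n) g \<in> unit_functions \<and> P ((G ^^ n) g) \<and> (\<forall>x. x \<notin> A \<longrightarrow> (G ^^ n) g x = g x)" for n
  proof (induction n)
    case (Suc n)
    then have "G ((G ^^ n) g) x = (G ^^ n) g x" if "x \<notin> A" for x
      using step that by blast
    then show ?case using Suc cong[of "(G ^^ n) g" "G ((G ^^ n) g)"] by (simp add: G_in)
  qed (use g P in auto)
  then show "(G ^^ n) g x = g x" if "x \<notin> A" for n x using that by blast
qed

section \<open>Lower bounds for the modulus of \<open>F f\<close>\<close>

definition modulus_bound :: "real \<Rightarrow> bool" where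
  "modulus_bound M \<longleftrightarrow> (\<forall>f\<in>unit_functions. \<forall>x. min \<bar>f x\<bar> M \<le> \<bar>F f x\<bar>)"

text \<open>The minimum is at most \<open>\<bar>g x\<bar> < M\<close>, hence it equals
  \<open>\<bar>G g x\<bar>\<close> and the modulus has not grown.\<close>

lemma G_eq_if_small:
  assumes "g \<in> unit_functions" "min \<bar>G g x\<bar> M \<le> \<bar>F (G g) x\<bar>" "\<bar>g x\<bar> < M"
  shows "G g x = g x"
  using assms F_G by (intro G_eq_if_modulus_le) auto

lemma G_eq_if_extreme:
  assumes "g \<in> unit_functions" "\<bar>g x\<bar> = 1"
  shows "G g x = g x"
  using assms G_in[of g] by (intro G_eq_if_modulus_le) (auto simp: unit_functions_def)

lemma fixed_if_small_or_extreme: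
  assumes M: "modulus_bound M" and g: "g \<in> unit_functions" and A: "finite A"
    and P: "\<And>x. x \<notin> A \<Longrightarrow> \<bar>g x\<bar> < M \<or> \<bar>g x\<bar> = 1"
  shows "F g = g"
proof (rule fixed_if_invariant[OF g A, where P = "\<lambda>h. \<forall>x. x \<notin> A \<longrightarrow> \<bar>h x\<bar> < M \<or> \<bar>h x\<bar> = 1"])
  fix h x assume h: "h \<in> unit_functions" "\<forall>x. x \<notin> A \<longrightarrow> \<bar>h x\<bar> < M \<or> \<bar>h x\<bar> = 1" and "x \<notin> A"
  have "min \<bar>G h x\<bar> M \<le> \<bar>F (G h) x\<bar>" using M G_in[OF h(1)] by (simp add: modulus_bound_def)
  then show "G h x = h x"
    using h \<open>x \<notin> A\<close> G_eq_if_small[OF h(1)] G_eq_if_extreme[OF h(1)] by blast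
qed (use P in auto)

text \<open>The value of the fixed point \<open>\<phi>\<close> at \<open>a\<close> is free, so it
  can be pushed beyond \<open>f a\<close> without leaving distance \<open>d\<close> of
  \<open>f\<close>; this forces \<open>F f a\<close> away from 0.\<close>

lemma modulus_bound_at_isolated:
  assumes f: "f \<in> unit_functions" and \<phi>: "\<phi> \<in> unit_functions" and a: "a \<in> isolated_points"
    and fixed: "\<And>t. \<bar>t\<bar> \<le> 1 \<Longrightarrow> F (\<phi>(a := t)) = \<phi>(a := t)"
    and d: "0 \<le> d" and close: "\<And>x. x \<noteq> a \<Longrightarrow> \<bar>f x - \<phi> x\<bar> \<le> d"
  shows "min \<bar>f a\<bar> (1 - d) \<le> \<bar>F f a\<bar>"
proof -
  \<comment> \<open>The value farthest from 0, on the side of \<open>f a\<close>, within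
    \<open>d\<close> of \<open>f a\<close> and inside the ball.\<close>
  define t where "t = (if 0 \<le> f a then min 1 (f a + d) else max (-1) (f a - d))"
  have fa: "\<bar>f a\<bar> \<le> 1" using f by (simp add: unit_functions_def)
  have t: "\<bar>t\<bar> \<le> 1" "\<bar>f a - t\<bar> \<le> d" using d fa by (auto simp: t_def)
  have "\<bar>F f a - F (\<phi>(a := t)) a\<bar> \<le> d"
    using f fun_upd_unit_functions[OF a \<phi> t(1)]
    by (rule nonexpansive) (use close t in auto)
  then have "\<bar>F f a - t\<bar> \<le> d" using fixed[OF t(1)] by simp
  then show ?thesis by (auto simp: t_def split: if_splits)
qed

lemma modulus_bound_everywhere:
  assumes f: "f \<in> unit_functions"
    and bound: "\<And>a \<eta>. a \<in> isolated_points \<Longrightarrow> 0 < \<eta> \<Longrightarrow> \<eta> < 1/8 \<Longrightarrow> min \<bar>f a\<bar> (M - \<eta>) \<le> \<bar>F f a\<bar>"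
  shows "min \<bar>f x\<bar> M \<le> \<bar>F f x\<bar>"
proof (rule closed_isolated_UNIV)
  have "continuous_on UNIV f" "continuous_on UNIV (F f)"
    using f F_in[OF f] by (auto simp: unit_functions_def)
  then show "closed {x. min \<bar>f x\<bar> M \<le> \<bar>F f x\<bar>}"
    by (intro closed_Collect_le continuous_intros) auto
  fix a :: 'a assume a: "a \<in> isolated_points"
  show "min \<bar>f a\<bar> M \<le> \<bar>F f a\<bar>"
  proof (rule field_le_epsilon)
    fix \<epsilon> :: real assume "0 < \<epsilon>"
    then show "min \<bar>f a\<bar> M \<le> \<bar>F f a\<bar> + \<epsilon>"
      \<comment> \<open>The cap \<open>1/9\<close> keeps the error below the admissible
        \<open>1/8\<close>.\<close>
      using bound[OF a, of "min \<epsilon> (1/9)"] by (cases "\<epsilon> \<le> 1/9") auto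
  qed
qed

text \<open>The set where \<open>\<bar>f\<bar> \<le> 1/2 - \<eta>\<close> is finite and clopen.
  Replacing \<open>f\<close> off it by its sign costs at most \<open>1/2 + \<eta>\<close> and gives
  a fixed point.\<close>

lemma modulus_bound_half_on_derived:
  assumes f: "f \<in> unit_functions" and half: "\<And>x. x \<notin> isolated_points \<Longrightarrow> 1/2 \<le> \<bar>f x\<bar>"
  shows "min \<bar>f x\<bar> (1/2) \<le> \<bar>F f x\<bar>"
proof (rule modulus_bound_everywhere[OF f])
  fix a :: 'a and \<eta> :: real
  assume a: "a \<in> isolated_points" and \<eta>: "0 < \<eta>" "\<eta> < 1/8"
  have cf: "continuous_on UNIV f" using f by (simp add: unit_functions_def)
  define A where "A = {x. \<bar>f x\<bar> \<le> 1/2 - \<eta>}"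
  have clA: "closed A" unfolding A_def using cf by (intro closed_Collect_le continuous_intros) auto
  have AI: "A \<subseteq> isolated_points" using half \<eta> by (fastforce simp: A_def)
  have finA: "finite A" by (rule finite_closed_isolated[OF clA AI])
  have opA: "open A" using open_UN[of A "\<lambda>x. {x}"] AI by (auto simp: isolated_points_def subset_iff)
  define D where "D = {x. x \<notin> A \<and> 0 < f x}"
  have D: "open D" "closed D"
  proof -
    \<comment> \<open>Off \<open>A\<close> the function \<open>f\<close> has no zeros, so strict and
      weak inequality describe the same set.\<close>
    have "D = - A \<inter> {x. 0 < f x}" by (auto simp: D_def)
    then show "open D" using clA cf by (auto intro!: open_Int open_Collect_less)
    have "D = - A \<inter> {x. 0 \<le> f x}" using \<eta> by (auto simp: D_def A_def)
    then show "closed D" using opA cf by (auto intro!: closed_Int closed_Collect_le)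
  qed
  define \<phi> where "\<phi> x = (if x \<in> A then f x else if x \<in> D then 1 else - 1)" for x
  have "continuous_on UNIV \<phi>"
    unfolding \<phi>_def using opA clA cf sign_function_of_clopen[OF D]
    by (intro continuous_on_if_clopen) (auto intro: continuous_on_subset simp: sign_functions_def)
  then have \<phi>: "\<phi> \<in> unit_functions" using f by (auto simp: unit_functions_def \<phi>_def)
  have "min \<bar>f a\<bar> (1 - (1/2 + \<eta>)) \<le> \<bar>F f a\<bar>"
  proof (rule modulus_bound_at_isolated[OF f \<phi> a])
    fix t :: real assume t: "\<bar>t\<bar> \<le> 1"
    \<comment> \<open>With \<open>M = 0\<close> the case of small modulus is void: off a finite set
      only modulus 1 is allowed.\<close>
    have "modulus_bound 0" by (simp add: modulus_bound_def)
    then show "F (\<phi>(a := t)) = \<phi>(a := t)"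
      using fun_upd_unit_functions[OF a \<phi> t]
      by (rule fixed_if_small_or_extreme[where A = "insert a A"]) (use finA in \<open>auto simp: \<phi>_def\<close>)
  next
    fix x
    have "\<bar>f x\<bar> \<le> 1" using f by (simp add: unit_functions_def)
    then show "\<bar>f x - \<phi> x\<bar> \<le> 1/2 + \<eta>" using \<eta> by (auto simp: \<phi>_def D_def A_def)
  qed (use \<eta> in auto)
  then show "min \<bar>f a\<bar> (1/2 - \<eta>) \<le> \<bar>F f a\<bar>" by (simp add: algebra_simps)
qed

text \<open>\<open>G\<close> does not lower moduli, so \<open>G h\<close> is still at least
  \<open>1/2\<close> in modulus on accumulation points and the previous bound applies to it. It pins
  isolated points, where \<open>\<bar>h\<bar> < 1/2\<close> strictly; density handles the
  rest.\<close>

lemma fixed_if_half_on_derived: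
  assumes g: "g \<in> unit_functions" and A: "finite A"
    and half: "\<And>x. x \<notin> isolated_points \<Longrightarrow> x \<notin> A \<Longrightarrow> \<bar>g x\<bar> = 1/2"
    and small: "\<And>x. x \<in> isolated_points \<Longrightarrow> x \<notin> A \<Longrightarrow> \<bar>g x\<bar> < 1/2"
    and AI: "A \<subseteq> isolated_points"
  shows "F g = g"
proof (rule fixed_if_invariant[OF g A, where P = "\<lambda>h. \<forall>x. x \<notin> A \<longrightarrow>
    (x \<notin> isolated_points \<longrightarrow> \<bar>h x\<bar> = 1/2) \<and> (x \<in> isolated_points \<longrightarrow> \<bar>h x\<bar> < 1/2)"])
  fix h x assume h: "h \<in> unit_functions" and P: "\<forall>x. x \<notin> A \<longrightarrow>
    (x \<notin> isolated_points \<longrightarrow> \<bar>h x\<bar> = 1/2) \<and> (x \<in> isolated_points \<longrightarrow> \<bar>h x\<bar> < 1/2)" and "x \<notin> A"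
  have "1/2 \<le> \<bar>G h y\<bar>" if "y \<notin> isolated_points" for y
    using G_sign_and_modulus(1)[OF h, of y] P that AI by force
  then have bound: "min \<bar>G h y\<bar> (1/2) \<le> \<bar>F (G h) y\<bar>" for y
    using modulus_bound_half_on_derived[OF G_in[OF h]] by blast
  have "G h x = h x \<or> x \<in> A"
  proof (rule closed_isolated_UNIV)
    have "continuous_on UNIV h" "continuous_on UNIV (G h)"
      using h G_in[OF h] by (auto simp: unit_functions_def)
    then have "closed ({x. G h x = h x} \<union> A)"
      using A by (intro closed_Un closed_Collect_eq finite_imp_closed) auto
    moreover have "{x. G h x = h x} \<union> A = {x. G h x = h x \<or> x \<in> A}" by auto
    ultimately show "closed {x. G h x = h x \<or> x \<in> A}" by simp
    fix y :: 'a assume "y \<in> isolated_points"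
    then show "G h y = h y \<or> y \<in> A" using P G_eq_if_small[OF h bound] by blast
  qed
  then show "G h x = h x" using \<open>x \<notin> A\<close> by simp
qed (use half small in auto)

text \<open>Any \<open>f\<close> is within \<open>1/2 + \<eta>\<close> of a function of modulus
  nearly \<open>1/2\<close> with its approximate sign. Lowering the modulus by a small multiple of
  \<open>\<theta>\<close> makes it smaller than \<open>1/2\<close> exactly at isolated points, as
  the fixed-point criterion requires.\<close>

lemma modulus_bound_half:
  fixes \<theta> :: "'a \<Rightarrow> real"
  assumes cont: "continuous_on UNIV \<theta>" and range: "\<And>x. 0 \<le> \<theta> x" "\<And>x. \<theta> x \<le> 1"
    and zero: "\<And>x. \<theta> x = 0 \<longleftrightarrow> x \<notin> isolated_points"
  shows "modulus_bound (1/2)"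
  unfolding modulus_bound_def
proof (intro ballI allI)
  fix f :: "'a \<Rightarrow> real" and x :: 'a assume f: "f \<in> unit_functions"
  show "min \<bar>f x\<bar> (1/2) \<le> \<bar>F f x\<bar>"
  proof (rule modulus_bound_everywhere[OF f])
    fix a :: 'a and \<eta> :: real
    assume a: "a \<in> isolated_points" and \<eta>: "0 < \<eta>" "\<eta> < 1/8"
    obtain D where D: "open D" "closed D" "\<And>x. 0 \<le> f x \<Longrightarrow> x \<in> D" "\<And>x. x \<in> D \<Longrightarrow> - (\<eta>/2) < f x"
      using approx_sign[of f "\<eta>/2"] f \<eta> by (auto simp: unit_functions_def)
    define p where "p x = \<eta>/2 * \<theta> x" for x
    define \<phi> where "\<phi> x = (if x \<in> D then 1 else - 1) * (1/2 - p x)" for x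
    have small: "0 \<le> p x" "p x \<le> \<eta>/2" for x
      using range[of x] \<eta> mult_left_le[of "\<theta> x" "\<eta>/2"] by (auto simp: p_def)
    have "continuous_on UNIV \<phi>"
      unfolding \<phi>_def p_def using sign_function_of_clopen[OF D(1,2)] cont
      by (intro continuous_intros) (auto simp: sign_functions_def)
    moreover have "\<bar>\<phi> x\<bar> \<le> 1" for x using small[of x] \<eta> by (auto simp: \<phi>_def)
    ultimately have \<phi>: "\<phi> \<in> unit_functions" by (simp add: unit_functions_def)
    have "min \<bar>f a\<bar> (1 - (1/2 + \<eta>)) \<le> \<bar>F f a\<bar>"
    proof (rule modulus_bound_at_isolated[OF f \<phi> a])
      fix t :: real assume t: "\<bar>t\<bar> \<le> 1"
      show "F (\<phi>(a := t)) = \<phi>(a := t)"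
      proof (rule fixed_if_half_on_derived[OF fun_upd_unit_functions[OF a \<phi> t], of "{a}"])
        fix x assume x: "x \<in> isolated_points" "x \<notin> {a}"
        then have "0 < p x" using zero[of x] range[of x] \<eta> by (simp add: p_def)
        then show "\<bar>(\<phi>(a := t)) x\<bar> < 1/2" using x small[of x] \<eta> by (auto simp: \<phi>_def)
      next
        fix x :: 'a assume "x \<notin> isolated_points" "x \<notin> {a}"
        then show "\<bar>(\<phi>(a := t)) x\<bar> = 1/2" using zero[of x] by (simp add: \<phi>_def p_def)
      qed (use a in auto)
    next
      fix x
      have "\<bar>f x\<bar> \<le> 1" using f by (simp add: unit_functions_def)
      then show "\<bar>f x - \<phi> x\<bar> \<le> 1/2 + \<eta>"
        using small[of x] D(3,4)[of x] \<eta> by (cases "x \<in> D"; cases "0 \<le> f x") (auto simp: \<phi>_def)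
    qed (use \<eta> in auto)
    then show "min \<bar>f a\<bar> (1/2 - \<eta>) \<le> \<bar>F f a\<bar>" by (simp add: algebra_simps)
  qed
qed

text \<open>Moduli above about \<open>(1 + M) / 2\<close>, the midpoint of \<open>M\<close> and 1,
  are rounded up to 1 and the others cut off just below \<open>M\<close>; either way the error is at
  most \<open>(1 - M) / 2 + \<eta>\<close>.\<close>

lemma modulus_bound_improve:
  assumes M: "modulus_bound M" "1/2 \<le> M" "M \<le> 1"
  shows "modulus_bound ((1 + M) / 2)"
  unfolding modulus_bound_def
proof (intro ballI allI)
  fix f :: "'a \<Rightarrow> real" and x :: 'a assume f: "f \<in> unit_functions"
  have cf: "continuous_on UNIV f" using f by (simp add: unit_functions_def)
  show "min \<bar>f x\<bar> ((1 + M) / 2) \<le> \<bar>F f x\<bar>"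
  proof (rule modulus_bound_everywhere[OF f])
    fix a :: 'a and \<eta> :: real
    assume a: "a \<in> isolated_points" and \<eta>: "0 < \<eta>" "\<eta> < 1/8"
    have "closed {x. (1 + M) / 2 \<le> \<bar>f x\<bar>}" "open {x. (1 + M) / 2 - \<eta> < \<bar>f x\<bar>}"
      using cf by (auto intro!: closed_Collect_le open_Collect_less continuous_intros)
    moreover have "{x. (1 + M) / 2 \<le> \<bar>f x\<bar>} \<subseteq> {x. (1 + M) / 2 - \<eta> < \<bar>f x\<bar>}"
      using \<eta> by (auto simp: field_simps)
    ultimately obtain D where D: "open D" "closed D"
      and D1: "{x. (1 + M) / 2 \<le> \<bar>f x\<bar>} \<subseteq> D" and D2: "D \<subseteq> {x. (1 + M) / 2 - \<eta> < \<bar>f x\<bar>}"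
      using clopen_between by blast
    have in_D: "(1 + M) / 2 - \<eta> < \<bar>f x\<bar>" if "x \<in> D" for x using D2 that by auto
    have not_D: "\<bar>f x\<bar> < (1 + M) / 2" if "x \<notin> D" for x
      using D1 that by (meson linorder_not_le mem_Collect_eq subsetD)
    \<comment> \<open>The cut-off is \<open>M - \<eta>\<close> because the criterion for fixed
      points needs modulus strictly below \<open>M\<close>.\<close>
    define \<phi> where "\<phi> x = (if x \<in> D then sgn (f x) else max (- (M - \<eta>)) (min (M - \<eta>) (f x)))" for x
    have "continuous_on D (\<lambda>x. sgn (f x))"
      using in_D M \<eta> by (intro continuous_on_sgn continuous_on_subset[OF cf]) force+
    moreover have "continuous_on (- D) (\<lambda>x. max (- (M - \<eta>)) (min (M - \<eta>) (f x)))"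
      by (intro continuous_intros continuous_on_subset[OF cf]) auto
    ultimately have "continuous_on UNIV \<phi>"
      unfolding \<phi>_def by (rule continuous_on_if_clopen[OF D])
    moreover have "\<bar>\<phi> x\<bar> \<le> 1" for x using M \<eta> by (auto simp: \<phi>_def sgn_if)
    ultimately have \<phi>: "\<phi> \<in> unit_functions" by (simp add: unit_functions_def)
    have "min \<bar>f a\<bar> (1 - ((1 - M) / 2 + \<eta>)) \<le> \<bar>F f a\<bar>"
    proof (rule modulus_bound_at_isolated[OF f \<phi> a])
      fix t :: real assume t: "\<bar>t\<bar> \<le> 1"
      show "F (\<phi>(a := t)) = \<phi>(a := t)"
      proof (rule fixed_if_small_or_extreme[OF M(1) fun_upd_unit_functions[OF a \<phi> t], of "{a}"])
        fix x assume "x \<notin> {a}"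
        then show "\<bar>(\<phi>(a := t)) x\<bar> < M \<or> \<bar>(\<phi>(a := t)) x\<bar> = 1"
          using in_D[of x] M \<eta> by (cases "x \<in> D") (auto simp: \<phi>_def sgn_if)
      qed simp
    next
      fix x
      have "\<bar>f x\<bar> \<le> 1" using f by (simp add: unit_functions_def)
      then show "\<bar>f x - \<phi> x\<bar> \<le> (1 - M) / 2 + \<eta>"
        using in_D[of x] not_D[of x] M \<eta>
        by (cases "x \<in> D") (auto simp: \<phi>_def sgn_if abs_if min_def max_def field_simps split: if_splits)
    qed (use \<eta> M in auto)
    moreover have "1 - ((1 - M) / 2 + \<eta>) = (1 + M) / 2 - \<eta>" by (simp add: field_simps)
    ultimately show "min \<bar>f a\<bar> ((1 + M) / 2 - \<eta>) \<le> \<bar>F f a\<bar>" by simp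
  qed
qed

text \<open>Repeated improvement from \<open>1/2\<close> halves the gap to 1 each time, and in the
  limit \<open>F\<close> preserves moduli; signs are preserved already.\<close>

lemma fixes_all:
  assumes "modulus_bound (1/2)" and f: "f \<in> unit_functions"
  shows "F f = f"
proof
  fix x
  have *: "modulus_bound (1 - (1/2) ^ Suc n)" for n
  proof (induction n)
    case (Suc n)
    have "(1/2 :: real) ^ Suc n \<le> (1/2) ^ 1" by (rule power_decreasing) auto
    then have "modulus_bound ((1 + (1 - (1/2) ^ Suc n)) / 2)"
      by (intro modulus_bound_improve Suc) auto
    then show ?case by (simp add: field_simps)
  qed (use assms in simp)
  have "(\<lambda>n. min \<bar>f x\<bar> (1 - (1/2) ^ Suc n)) \<longlonglongrightarrow> min \<bar>f x\<bar> (1 - 0)"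
    by (intro tendsto_intros LIMSEQ_Suc LIMSEQ_power_zero) simp
  then have "min \<bar>f x\<bar> (1 - 0) \<le> \<bar>F f x\<bar>"
    by (rule LIMSEQ_le_const2) (use * f in \<open>auto simp: modulus_bound_def\<close>)
  moreover have "\<bar>f x\<bar> \<le> 1" using f by (simp add: unit_functions_def)
  ultimately have "\<bar>f x\<bar> = \<bar>F f x\<bar>" using sign_and_modulus(1)[OF f, of x] by simp
  then have "F f x = f x \<or> F f x = - f x" by linarith
  then show "F f x = f x" using sign_and_modulus(2)[OF f, of x] by (auto simp: zero_le_mult_iff)
qed

end

section \<open>Reduction to the sign-fixing case\<close>

definition spike :: "'a \<Rightarrow> real \<Rightarrow> 'a \<Rightarrow> real" where
  "spike a w = (\<lambda>_. 0)(a := w)"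

lemma spike_in_unit_functions:
  fixes a :: "'a::t2_space"
  assumes "a \<in> isolated_points" "\<bar>w\<bar> \<le> 1"
  shows "spike a w \<in> unit_functions"
  unfolding spike_def using assms by (intro fun_upd_unit_functions) (auto simp: unit_functions_def)

context nonexpansive_ball_bijection
begin

section \<open>Zero, antipodes and extreme points\<close>

lemma F_eq_iff: "f \<in> unit_functions \<Longrightarrow> g \<in> unit_functions \<Longrightarrow> F f = F g \<longleftrightarrow> f = g"
  by (metis G_F)

text \<open>0 is within 1 of the whole ball, so by surjectivity \<open>F 0\<close> is within 1 of
  both constants 1 and -1.\<close>

lemma F_zero: "F (\<lambda>_. 0) = (\<lambda>_. 0)"
proof
  fix x
  have "\<bar>F (\<lambda>_. 0) x - c\<bar> \<le> 1" if "\<bar>c\<bar> = 1" for c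
  proof -
    have c: "(\<lambda>_. c) \<in> unit_functions" using that by (simp add: unit_functions_def)
    have "\<bar>F (\<lambda>_. 0) x - F (G (\<lambda>_. c)) x\<bar> \<le> 1"
      by (rule nonexpansive) (use G_in[OF c] in \<open>auto simp: unit_functions_def\<close>)
    then show ?thesis by (simp add: F_G[OF c])
  qed
  from this[of 1] this[of "-1"] show "F (\<lambda>_. 0) x = 0" by simp
qed

lemma minus_sign_function: "e \<in> sign_functions \<Longrightarrow> (\<lambda>x. - e x) \<in> sign_functions"
  by (auto simp: sign_functions_def intro!: continuous_intros)

text \<open>\<open>F m\<close> is within 1 of \<open>e\<close> and of \<open>- e\<close>, hence 0;
  injectivity concludes.\<close>

lemma zero_if_close_to_antipodes:
  assumes e: "e \<in> sign_functions" and m: "m \<in> unit_functions"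
    and "\<And>x. \<bar>m x - G e x\<bar> \<le> 1" "\<And>x. \<bar>m x - G (\<lambda>x. - e x) x\<bar> \<le> 1"
  shows "m x = 0"
proof -
  have E: "e \<in> unit_functions" "(\<lambda>x. - e x) \<in> unit_functions"
    using e minus_sign_function[OF e] sign_functions_subset by auto
  have "F m y = 0" for y
  proof -
    have "\<bar>F m y - e y\<bar> \<le> 1"
      using nonexpansive[OF m G_in[OF E(1)] assms(3), of y] F_G[OF E(1)] by simp
    moreover have "\<bar>F m y + e y\<bar> \<le> 1"
      using nonexpansive[OF m G_in[OF E(2)] assms(4), of y] F_G[OF E(2)] by simp
    ultimately show ?thesis using sign_function_cases[OF e, of y] by auto
  qed
  then have "F m = F (\<lambda>_. 0)" using F_zero by auto
  then have "m = (\<lambda>_. 0)" using F_eq_iff[OF m] by (simp add: unit_functions_def)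
  then show ?thesis by simp
qed

text \<open>The midpoint of the two preimages is within 1 of each, so it is 0.\<close>

lemma G_minus_sign:
  assumes e: "e \<in> sign_functions"
  shows "G (\<lambda>x. - e x) x = - G e x"
proof -
  have G: "G e \<in> unit_functions" "G (\<lambda>x. - e x) \<in> unit_functions"
    using e minus_sign_function[OF e] sign_functions_subset G_in by auto
  have b: "\<bar>G e y\<bar> \<le> 1" "\<bar>G (\<lambda>x. - e x) y\<bar> \<le> 1" for y
    using G by (auto simp: unit_functions_def)
  let ?m = "\<lambda>y. (G e y + G (\<lambda>x. - e x) y) / 2"
  have "continuous_on UNIV ?m"
    using G by (auto simp: unit_functions_def intro!: continuous_intros)
  moreover have "\<bar>?m y\<bar> \<le> 1" for y using b[of y] by (auto simp: abs_le_iff)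
  ultimately have "?m \<in> unit_functions" by (simp add: unit_functions_def)
  then have "?m x = 0"
  proof (rule zero_if_close_to_antipodes[OF e])
    fix y
    show "\<bar>?m y - G e y\<bar> \<le> 1" "\<bar>?m y - G (\<lambda>x. - e x) y\<bar> \<le> 1"
      using b[of y] by (auto simp: abs_le_iff field_simps)
  qed
  then show ?thesis by simp
qed

lemma G_sign:
  assumes e: "e \<in> sign_functions"
  shows "G e \<in> sign_functions"
proof -
  have G: "G e \<in> unit_functions" using e sign_functions_subset G_in by auto
  have b: "\<bar>G e y\<bar> \<le> 1" for y using G by (simp add: unit_functions_def)
  \<comment> \<open>\<open>G e\<close> is extreme: both \<open>G e \<plusminus> m\<close> stay in the ball.\<close>
  let ?m = "\<lambda>y. 1 - \<bar>G e y\<bar>"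
  have "continuous_on UNIV ?m"
    using G by (auto simp: unit_functions_def intro!: continuous_intros)
  then have "?m \<in> unit_functions" using b by (simp add: unit_functions_def)
  then have "?m x = 0" for x
  proof (rule zero_if_close_to_antipodes[OF e])
    fix y
    show "\<bar>?m y - G e y\<bar> \<le> 1" "\<bar>?m y - G (\<lambda>x. - e x) y\<bar> \<le> 1"
      using b[of y] by (auto simp: G_minus_sign[OF e])
  qed
  then show ?thesis using G by (simp add: sign_functions_def unit_functions_def)
qed

text \<open>If \<open>G e a = w\<close>, the spike is within 1 of \<open>G e\<close>, so its image
  \<open>g\<close> is within 1 of \<open>e\<close> and nowhere of opposite sign; otherwise this
  holds for \<open>- e\<close>. Hence each \<open>g * e\<close> has constant sign.\<close>

lemma spike_image:
  assumes a: "a \<in> isolated_points" and w: "\<bar>w\<bar> = 1"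
  obtains b t where "t \<noteq> 0" "F (spike a w) = spike b t"
    "\<And>e. e \<in> sign_functions \<Longrightarrow> G e a = w * sgn t * e b"
proof -
  define g where "g = F (spike a w)"
  have sp: "spike a w \<in> unit_functions" using a w by (simp add: spike_in_unit_functions)
  have w': "w = 1 \<or> w = -1" using w by linarith
  have nonneg: "0 \<le> g x * e x" if e: "e \<in> sign_functions" "G e a = w" for e x
  proof -
    have eu: "e \<in> unit_functions" using e sign_functions_subset by auto
    have "\<bar>spike a w y - G e y\<bar> \<le> 1" for y
      using e(2) G_in[OF eu] by (auto simp: spike_def unit_functions_def)
    then have "\<bar>g x - F (G e) x\<bar> \<le> 1"
      unfolding g_def by (rule nonexpansive[OF sp G_in[OF eu]])
    then show ?thesis using F_G[OF eu] sign_function_cases[OF e(1), of x] by auto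
  qed
  have cases: "G e a = w \<and> (\<forall>x. 0 \<le> g x * e x) \<or> G e a = - w \<and> (\<forall>x. g x * e x \<le> 0)"
    if e: "e \<in> sign_functions" for e
  proof (cases "G e a = w")
    case False
    then have ne: "G e a = - w" using sign_function_cases[OF G_sign[OF e], of a] w' by auto
    then have "0 \<le> g x * (- e x)" for x
      using nonneg[OF minus_sign_function[OF e]] G_minus_sign[OF e] by simp
    then show ?thesis using ne by simp
  qed (use nonneg e in auto)
  have "g \<noteq> (\<lambda>_. 0)"
  proof
    assume "g = (\<lambda>_. 0)"
    then have "spike a w = (\<lambda>_. 0)"
      using F_eq_iff[OF sp, of "\<lambda>_. 0"] by (simp add: g_def F_zero unit_functions_def)
    from fun_cong[OF this, of a] show False using w by (simp add: spike_def)
  qed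
  then obtain b where b: "g b \<noteq> 0" by auto
  have "g c = 0" if c: "b \<noteq> c" for c
  proof -
    obtain e where e: "e \<in> sign_functions" "e b = 1" "e c = -1"
      using sign_separation[OF c] .
    have "(\<lambda>_. 1) \<in> sign_functions" by (simp add: sign_functions_def)
    \<comment> \<open>Neither \<open>g\<close> nor \<open>g * e\<close> changes sign, but
      \<open>e\<close> differs at \<open>b\<close> and \<open>c\<close>; since \<open>g b\<close> is
      nonzero, \<open>g c\<close> vanishes.\<close>
    from cases[OF this] cases[OF e(1)] show ?thesis
      using b e(2,3) by (metis mult.right_neutral mult_minus1_right neg_0_le_iff_le neg_le_0_iff_le
          order_antisym)
  qed
  then have gs: "g = spike b (g b)" by (auto simp: spike_def)
  show ?thesis
  proof (rule that[OF b])
    show "F (spike a w) = spike b (g b)" using gs by (simp add: g_def)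
    fix e :: "'a \<Rightarrow> real" assume e: "e \<in> sign_functions"
    have "G e a = w \<and> 0 \<le> g b * e b \<or> G e a = - w \<and> g b * e b \<le> 0" using cases[OF e] by blast
    then show "G e a = w * sgn (g b) * e b"
      using b sign_function_cases[OF e, of b] by (auto simp: sgn_if)
  qed
qed

section \<open>The sign function \<open>\<epsilon>\<close> and the point map
  \<open>\<sigma>\<close>\<close>

definition \<epsilon> :: "'a \<Rightarrow> real" where
  "\<epsilon> = G (\<lambda>_. 1)"

text \<open>Such a point exists by \<open>\<sigma>_eq\<close> and is unique because sign functions
  separate points.\<close>

definition \<sigma> :: "'a \<Rightarrow> 'a" where
  "\<sigma> x = (SOME y. \<forall>e\<in>sign_functions. G e x = \<epsilon> x * e y)"

lemma one_sign: "(\<lambda>_. 1) \<in> sign_functions"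
  by (simp add: sign_functions_def)

lemma \<epsilon>_sign: "\<epsilon> \<in> sign_functions"
  unfolding \<epsilon>_def by (rule G_sign[OF one_sign])

lemma \<epsilon>_cases: "\<epsilon> x = 1 \<or> \<epsilon> x = -1"
  by (rule sign_function_cases[OF \<epsilon>_sign])

lemma spike_image_sign:
  assumes a: "a \<in> isolated_points" and w: "\<bar>w\<bar> = 1"
  obtains b t where "t \<noteq> 0" "F (spike a w) = spike b t" "sgn t = w * \<epsilon> a"
    "\<And>e. e \<in> sign_functions \<Longrightarrow> G e a = \<epsilon> a * e b"
proof -
  obtain b t where t: "t \<noteq> 0" "F (spike a w) = spike b t"
    and G: "\<And>e. e \<in> sign_functions \<Longrightarrow> G e a = w * sgn t * e b"
    using spike_image[OF a w] by metis
  have "\<epsilon> a = w * sgn t" using G[OF one_sign] by (simp add: \<epsilon>_def)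
  moreover have "w * w = 1" using w by (metis abs_mult_self_eq mult_1)
  ultimately have "sgn t = w * \<epsilon> a" by (metis mult.assoc mult_1)
  then show ?thesis using that[OF t] G \<open>\<epsilon> a = w * sgn t\<close> by simp
qed

text \<open>By compactness it suffices to meet finitely many conditions at once. The functions
  \<open>G e\<close> are locally constant, so an isolated point near \<open>x\<close> has the same
  values, and its spike image gives the point.\<close>

lemma \<sigma>_eq:
  assumes "e \<in> sign_functions"
  shows "G e x = \<epsilon> x * e (\<sigma> x)"
proof -
  let ?C = "\<lambda>e. {y. e y = \<epsilon> x * G e x}"
  have "UNIV \<inter> (\<Inter>e\<in>sign_functions. ?C e) \<noteq> {}"
  proof (rule compact_imp_fip_image[OF compact_UNIV])
    fix E :: "('a \<Rightarrow> real) set" assume E: "finite E" "E \<subseteq> sign_functions"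
    \<comment> \<open>The constant 1 is included so that also
      \<open>\<epsilon> a = \<epsilon> x\<close>.\<close>
    let ?W = "\<Inter>e\<in>insert (\<lambda>_. 1) E. {y. G e y = G e x}"
    have "open ?W"
      using E one_sign by (intro open_INT ballI clopen_level_set_sign G_sign) auto
    then obtain a where a: "a \<in> isolated_points" "a \<in> ?W"
      using open_meets_isolated[of ?W x] by auto
    obtain b where b: "\<And>e. e \<in> sign_functions \<Longrightarrow> G e a = \<epsilon> a * e b"
      using spike_image_sign[OF a(1), of 1] by auto
    have "\<epsilon> a = \<epsilon> x" using a(2) by (simp add: \<epsilon>_def)
    then have "e b = \<epsilon> x * G e x" if "e \<in> E" for e
      using b[of e] E that a(2) \<epsilon>_cases[of x] by auto
    then show "UNIV \<inter> (\<Inter>e\<in>E. ?C e) \<noteq> {}" by auto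
  qed (auto intro: clopen_level_set_sign)
  then obtain y where y: "e y = \<epsilon> x * G e x" if "e \<in> sign_functions" for e by auto
  have "G e x = \<epsilon> x * e y" if "e \<in> sign_functions" for e
    using y[OF that] \<epsilon>_cases[of x] by auto
  then have "\<forall>e\<in>sign_functions. G e x = \<epsilon> x * e y" by blast
  then have "\<forall>e\<in>sign_functions. G e x = \<epsilon> x * e (\<sigma> x)"
    unfolding \<sigma>_def by (rule someI[where P = "\<lambda>y. \<forall>e\<in>sign_functions. G e x = \<epsilon> x * e y"])
  then show ?thesis using assms by blast
qed

lemma spike_image_\<sigma>:
  assumes a: "a \<in> isolated_points" and w: "\<bar>w\<bar> = 1"
  obtains t where "t \<noteq> 0" "F (spike a w) = spike (\<sigma> a) t" "sgn t = w * \<epsilon> a"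
proof -
  obtain b t where t: "t \<noteq> 0" "F (spike a w) = spike b t" "sgn t = w * \<epsilon> a"
    and G: "\<And>e. e \<in> sign_functions \<Longrightarrow> G e a = \<epsilon> a * e b"
    using spike_image_sign[OF a w] by metis
  have "b = \<sigma> a"
  proof (rule ccontr)
    assume "b \<noteq> \<sigma> a"
    obtain e where e: "e \<in> sign_functions" "e b = 1" "e (\<sigma> a) = -1"
      using sign_separation[OF \<open>b \<noteq> \<sigma> a\<close>] .
    then show False using G[OF e(1)] \<sigma>_eq[OF e(1), of a] \<epsilon>_cases[of a] by auto
  qed
  then show ?thesis using that t by simp
qed

text \<open>The preimage of a clopen \<open>V\<close> is a level set of the sign function
  \<open>\<epsilon> * G e\<close>, where \<open>e\<close> is 1 exactly on \<open>V\<close>.\<close>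

lemma continuous_\<sigma>: "continuous_on UNIV \<sigma>"
proof -
  have "open (\<sigma> -` W)" if W: "open W" for W
  proof (subst open_subopen, safe)
    fix x assume "\<sigma> x \<in> W"
    then obtain V where V: "open V" "closed V" "\<sigma> x \<in> V" "V \<subseteq> W"
      using clopen_base[OF W] by blast
    define e :: "'a \<Rightarrow> real" where "e y = (if y \<in> V then 1 else - 1)" for y
    have e: "e \<in> sign_functions"
      using sign_function_of_clopen[OF V(1,2)] by (simp add: e_def[abs_def])
    have "\<epsilon> y * G e y = 1 \<longleftrightarrow> \<sigma> y \<in> V" for y
      using \<sigma>_eq[OF e, of y] \<epsilon>_cases[of y] by (auto simp: e_def)
    then have eq: "\<sigma> -` V = {y. \<epsilon> y * G e y = 1}" by auto
    have "(\<lambda>y. \<epsilon> y * G e y) \<in> sign_functions"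
      using \<epsilon>_sign G_sign[OF e] by (auto simp: sign_functions_def abs_mult intro!: continuous_intros)
    then have "open (\<sigma> -` V)" unfolding eq by (rule clopen_level_set_sign)
    then show "\<exists>T. open T \<and> x \<in> T \<and> T \<subseteq> \<sigma> -` W" using V by blast
  qed
  then show ?thesis by (simp add: continuous_on_open_vimage)
qed

text \<open>A sign function equal to -1 only on a clopen set missing the range has the same image
  under \<open>G\<close> as the constant 1.\<close>

lemma surj_\<sigma>: "surj \<sigma>"
proof (rule ccontr)
  assume "\<not> surj \<sigma>"
  then obtain y where y: "y \<notin> range \<sigma>" by auto
  have "closed (range \<sigma>)"
    using compact_continuous_image[OF continuous_\<sigma> compact_UNIV] by (rule compact_imp_closed)
  then obtain V where V: "open V" "closed V" "y \<in> V" "V \<subseteq> - range \<sigma>"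
    using clopen_base[of "- range \<sigma>" y] y by auto
  define e :: "'a \<Rightarrow> real" where "e x = (if x \<in> - V then 1 else - 1)" for x
  have e: "e \<in> sign_functions"
    using sign_function_of_clopen[of "- V"] V by (simp add: e_def[abs_def] open_Compl closed_Compl)
  have "G e x = G (\<lambda>_. 1) x" for x
    using \<sigma>_eq[OF e, of x] V(4) by (auto simp: e_def \<epsilon>_def)
  then have "F (G e) = F (G (\<lambda>_. 1))" by presburger
  then have "e = (\<lambda>_. 1)" using F_G e one_sign sign_functions_subset by (metis subsetD)
  from fun_cong[OF this, of y] show False using V by (simp add: e_def)
qed

section \<open>Injectivity of \<open>\<sigma>\<close>\<close>

lemma sign_at_extreme_value:
  assumes f: "f \<in> unit_functions" and a: "a \<in> isolated_points" and ext: "\<bar>F f (\<sigma> a)\<bar> = 1"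
  shows "0 \<le> f a * \<epsilon> a * F f (\<sigma> a)"
proof (rule ccontr)
  assume neg: "\<not> ?thesis"
  \<comment> \<open>\<open>w\<close> has the sign of \<open>f a\<close>, so the spike is within 1 of
    \<open>f\<close>; its image has at \<open>\<sigma> a\<close> the sign opposite to
    \<open>F f\<close>, which has modulus 1 there, at distance over 1.\<close>
  define w where "w = - \<epsilon> a * F f (\<sigma> a)"
  have w: "\<bar>w\<bar> = 1" using ext \<epsilon>_cases[of a] by (auto simp: w_def abs_mult)
  obtain t where t: "t \<noteq> 0" "F (spike a w) = spike (\<sigma> a) t" "sgn t = w * \<epsilon> a"
    using spike_image_\<sigma>[OF a w] .
  have fb: "\<bar>f y\<bar> \<le> 1" for y using f by (simp add: unit_functions_def)
  have "0 < f a * w" using neg by (simp add: w_def mult_ac)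
  moreover have "w = 1 \<or> w = -1" using w by linarith
  ultimately have "\<bar>f a - w\<bar> \<le> 1" using fb[of a] by auto
  then have "\<bar>f y - spike a w y\<bar> \<le> 1" for y using fb[of y] by (simp add: spike_def)
  then have "\<bar>F f (\<sigma> a) - F (spike a w) (\<sigma> a)\<bar> \<le> 1"
    using nonexpansive[OF f spike_in_unit_functions[OF a]] w by simp
  then have "\<bar>F f (\<sigma> a) - t\<bar> \<le> 1" unfolding t(2) by (simp add: spike_def)
  moreover have "sgn t = - F f (\<sigma> a)" using t(3) \<epsilon>_cases[of a] by (auto simp: w_def)
  ultimately show False using ext t(1) by (auto simp: sgn_if split: if_splits)
qed

text \<open>Near the common image of \<open>u\<close> and \<open>v\<close>, \<open>F f\<close>
  determines the weak sign of \<open>\<epsilon> * f\<close> on preimages. Choosing the sign of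
  \<open>f u * f v\<close> as \<open>- \<epsilon> u * \<epsilon> v\<close> contradicts this.\<close>

lemma inj_\<sigma>_if_star:
  assumes star: "\<And>u v z w. u \<noteq> v \<Longrightarrow> w \<in> {-1, 1} \<Longrightarrow> \<exists>f\<in>unit_functions. sgn (f u * f v) = w \<and>
      (\<exists>W. open W \<and> z \<in> W \<and> (\<forall>x\<in>W. \<bar>F f x\<bar> = 1))"
  shows "inj \<sigma>"
proof (rule injI, rule ccontr)
  fix u v assume uv: "\<sigma> u = \<sigma> v" "u \<noteq> v"
  have "- \<epsilon> u * \<epsilon> v \<in> {-1, 1}" using \<epsilon>_cases[of u] \<epsilon>_cases[of v] by auto
  then obtain f W where f: "f \<in> unit_functions" "sgn (f u * f v) = - \<epsilon> u * \<epsilon> v"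
    and W: "open W" "\<sigma> u \<in> W" "\<And>x. x \<in> W \<Longrightarrow> \<bar>F f x\<bar> = 1"
    using star[OF uv(2), of "- \<epsilon> u * \<epsilon> v" "\<sigma> u"] by blast
  have cont: "continuous_on UNIV (\<lambda>x. f x * \<epsilon> x * F f (\<sigma> x))"
    using f(1) F_in[OF f(1)] \<epsilon>_sign continuous_\<sigma>
    by (auto simp: unit_functions_def sign_functions_def
        intro!: continuous_intros continuous_on_compose2[of UNIV "F f" UNIV \<sigma>])
  have nonneg: "0 \<le> f x * \<epsilon> x * F f (\<sigma> x)" if x: "\<sigma> x \<in> W" for x
  proof (rule ccontr)
    assume "\<not> ?thesis"
    then have "x \<in> {x. f x * \<epsilon> x * F f (\<sigma> x) < 0} \<inter> \<sigma> -` W" using x by simp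
    moreover have "open ({x. f x * \<epsilon> x * F f (\<sigma> x) < 0} \<inter> \<sigma> -` W)"
      using cont W continuous_\<sigma>
      by (intro open_Int open_Collect_less open_vimage) auto
    ultimately obtain a where "a \<in> isolated_points" "f a * \<epsilon> a * F f (\<sigma> a) < 0" "\<sigma> a \<in> W"
      using open_meets_isolated by fastforce
    then show False using sign_at_extreme_value[OF f(1)] W(3) by fastforce
  qed
  have "F f (\<sigma> u) = 1 \<or> F f (\<sigma> u) = -1" using W(3)[OF W(2)] by linarith
  then have "0 \<le> (f u * \<epsilon> u) * (f v * \<epsilon> v)"
    using nonneg[of u] nonneg[of v] W(2) uv(1)
    by (auto simp: zero_le_mult_iff mult_le_0_iff)
  then show False
    using f(2) \<epsilon>_cases[of u] \<epsilon>_cases[of v] by (auto simp: sgn_if split: if_splits)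
qed

text \<open>With \<open>s\<close> separating \<open>u\<close> and \<open>v\<close>,
  \<open>f = \<epsilon> * s / 2\<close> is within \<open>1/2\<close> of each spike with value
  \<open>s a * \<epsilon> a\<close>. Spike images of height over \<open>1/2\<close> force
  \<open>F f (\<sigma> x)\<close> to have the sign \<open>s x\<close>, impossible at both
  points.\<close>

lemma inj_\<sigma>_if_large_spikes:
  assumes c: "1/2 < c"
    and large: "\<And>a w b t. a \<in> isolated_points \<Longrightarrow> w \<in> {-1, 1} \<Longrightarrow> F (spike a w) = spike b t \<Longrightarrow> c \<le> \<bar>t\<bar>"
  shows "inj \<sigma>"
proof (rule injI, rule ccontr)
  fix u v assume uv: "\<sigma> u = \<sigma> v" "u \<noteq> v"
  obtain D where D: "open D" "closed D" "u \<in> D" "v \<notin> D" using clopen_separation[OF uv(2)] .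
  define s :: "'a \<Rightarrow> real" where "s x = (if x \<in> D then 1 else - 1)" for x
  have s: "s \<in> sign_functions" using sign_function_of_clopen[OF D(1,2)] by (simp add: s_def[abs_def])
  define f where "f x = \<epsilon> x * s x / 2" for x
  have f: "f \<in> unit_functions"
    using s \<epsilon>_sign
    by (auto simp: unit_functions_def sign_functions_def f_def abs_mult intro!: continuous_intros)
  have isolated: "c - 1/2 \<le> s a * F f (\<sigma> a)" if a: "a \<in> isolated_points" for a
  proof -
    define w where "w = s a * \<epsilon> a"
    have w: "w = 1 \<or> w = -1" using \<epsilon>_cases[of a] sign_function_cases[OF s, of a] by (auto simp: w_def)
    then have w1: "\<bar>w\<bar> = 1" by auto
    obtain t where t: "t \<noteq> 0" "F (spike a w) = spike (\<sigma> a) t" "sgn t = w * \<epsilon> a"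
      using spike_image_\<sigma>[OF a w1] .
    have ct: "c \<le> \<bar>t\<bar>" using large[OF a _ t(2)] w by auto
    have "\<bar>f y - spike a w y\<bar> \<le> 1/2" for y
      using \<epsilon>_cases[of y] sign_function_cases[OF s, of y] by (auto simp: f_def w_def spike_def)
    moreover have "spike a w \<in> unit_functions" using a w1 by (simp add: spike_in_unit_functions)
    ultimately have "\<bar>F f (\<sigma> a) - F (spike a w) (\<sigma> a)\<bar> \<le> 1/2"
      using nonexpansive[OF f] by blast
    then have "\<bar>F f (\<sigma> a) - t\<bar> \<le> 1/2" unfolding t(2) by (simp add: spike_def)
    moreover have "sgn t = s a" using t(3) \<epsilon>_cases[of a] by (auto simp: w_def)
    ultimately have "s a = 1 \<and> c \<le> t \<or> s a = -1 \<and> t \<le> - c" "\<bar>F f (\<sigma> a) - t\<bar> \<le> 1/2"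
      using ct t(1) by (auto simp: sgn_if split: if_splits)
    then show ?thesis by (elim disjE conjE; simp only: abs_le_iff) linarith+
  qed
  have "closed {x. c - 1/2 \<le> s x * F f (\<sigma> x)}"
    using s F_in[OF f] continuous_\<sigma>
    by (auto simp: unit_functions_def sign_functions_def
        intro!: closed_Collect_le continuous_intros continuous_on_compose2[of UNIV "F f" UNIV \<sigma>])
  then have "c - 1/2 \<le> s x * F f (\<sigma> x)" for x
    using isolated by (rule closed_isolated_UNIV)
  from this[of u] this[of v] show False using uv D c by (simp add: s_def)
qed

text \<open>The isometric bijection \<open>L\<close> agrees with \<open>G\<close> on sign functions,
  so \<open>F \<circ> L\<close> fixes them and is the identity; thus \<open>F\<close> is the inverse
  \<open>L'\<close>.\<close>

lemma F_formula:
  assumes inj: "inj \<sigma>"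
    and \<theta>: "continuous_on UNIV \<theta>" "\<And>x. 0 \<le> \<theta> x" "\<And>x. \<theta> x \<le> (1::real)"
      "\<And>x. \<theta> x = 0 \<longleftrightarrow> x \<notin> (isolated_points :: 'a set)"
    and f: "f \<in> unit_functions"
  shows "F f (\<sigma> x) = \<epsilon> x * f x"
proof -
  define \<tau> where "\<tau> = inv \<sigma>"
  have \<tau>\<sigma>: "\<tau> (\<sigma> x) = x" and \<sigma>\<tau>: "\<sigma> (\<tau> x) = x" for x
    using inj surj_\<sigma> by (auto simp: \<tau>_def surj_f_inv_f)
  have "continuous_on (range \<sigma>) \<tau>"
    using \<tau>\<sigma> by (intro continuous_on_inv[OF continuous_\<sigma> compact_UNIV]) auto
  then have c\<tau>: "continuous_on UNIV \<tau>" using surj_\<sigma> by simp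
  define L where "L h = (\<lambda>x. \<epsilon> x * h (\<sigma> x))" for h :: "'a \<Rightarrow> real"
  define L' where "L' h = (\<lambda>y. \<epsilon> (\<tau> y) * h (\<tau> y))" for h :: "'a \<Rightarrow> real"
  have \<epsilon>c: "continuous_on UNIV \<epsilon>" and \<epsilon>1: "\<bar>\<epsilon> x\<bar> = 1" for x
    using \<epsilon>_sign by (auto simp: sign_functions_def)
  have L: "L h \<in> unit_functions" if "h \<in> unit_functions" for h
    using that \<epsilon>c \<epsilon>1 continuous_\<sigma> unfolding L_def
    by (auto simp: unit_functions_def abs_mult
        intro!: continuous_intros continuous_on_compose2[of UNIV h UNIV \<sigma>])
  have L': "L' h \<in> unit_functions" if "h \<in> unit_functions" for h
    using that \<epsilon>c \<epsilon>1 c\<tau> unfolding L'_def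
    by (auto simp: unit_functions_def abs_mult
        intro!: continuous_intros continuous_on_compose2[of UNIV h UNIV \<tau>]
          continuous_on_compose2[of UNIV \<epsilon> UNIV \<tau>])
  have \<epsilon>\<epsilon>: "\<epsilon> x * (\<epsilon> x * r) = r" for x r using \<epsilon>_cases[of x] by auto
  have LL': "L (L' h) = h" "L' (L h) = h" for h
    by (auto simp: L_def L'_def \<tau>\<sigma> \<sigma>\<tau> \<epsilon>\<epsilon>)
  have "bij_betw L unit_functions unit_functions"
    by (rule bij_betw_byWitness[where f' = L']) (use L L' LL' in auto)
  then have bijL: "bij_betw (F \<circ> L) unit_functions unit_functions"
    using bij by (rule bij_betw_trans)
  interpret L: sign_fixing_bijection T "F \<circ> L"
  proof unfold_locales
    fix f g :: "'a \<Rightarrow> real" and d x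
    assume fg: "f \<in> unit_functions" "g \<in> unit_functions" "\<And>y. \<bar>f y - g y\<bar> \<le> d"
    have "\<bar>L f y - L g y\<bar> \<le> d" for y
      using fg(3)[of "\<sigma> y"] \<epsilon>1[of y] by (simp add: L_def abs_mult flip: right_diff_distrib)
    then show "\<bar>(F \<circ> L) f x - (F \<circ> L) g x\<bar> \<le> d"
      using nonexpansive L fg by simp
  next
    fix e :: "'a \<Rightarrow> real" assume e: "e \<in> sign_functions"
    then have "L e = G e" using \<sigma>_eq by (auto simp: L_def)
    then show "(F \<circ> L) e = e" using F_G e sign_functions_subset by auto
  qed (fact bijL)
  have "(F \<circ> L) (L' f) = L' f"
    by (rule L.fixes_all[OF L.modulus_bound_half[OF \<theta>] L'[OF f]])
  then have "F f = L' f" by (simp add: LL')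
  then show ?thesis by (simp add: L'_def \<tau>\<sigma>)
qed

end

section \<open>Consequences of the G-delta condition\<close>

lemma isolated_points_eq: "isolated_points = {x. x isolated_in UNIV}"
  by (auto simp: isolated_points_def isolated_in_def)

lemma limit_points_eq: "{x. x islimpt UNIV} = - isolated_points"
  by (auto simp: isolated_points_def islimpt_UNIV_iff)

context zero_dim_compactum
begin

text \<open>Each open set containing the accumulation points has finite complement, and the
  complements of countably many exhaust the isolated points.\<close>

lemma countable_isolated:
  assumes "gdelta_in euclidean (- isolated_points :: 'a set)"
  shows "countable (isolated_points :: 'a set)"
proof -
  obtain \<U> :: "'a set set" where \<U>: "countable \<U>" "\<And>U. U \<in> \<U> \<Longrightarrow> open U"
    and eq: "\<Inter>\<U> = - isolated_points"
    using assms unfolding gdelta_in_alt intersection_of_def by auto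
  have "finite (- U)" if "U \<in> \<U>" for U
    using \<U>(2)[OF that] eq that by (intro finite_closed_isolated) auto
  then have "countable (\<Union>U\<in>\<U>. - U)"
    using \<U>(1) by (intro countable_UN) (auto intro: countable_finite)
  moreover have "(\<Union>U\<in>\<U>. - U) = isolated_points" using eq by auto
  ultimately show ?thesis by simp
qed

text \<open>Values \<open>1 / (1 + n)\<close> along an enumeration exceed any \<open>d > 0\<close>
  only finitely often, which gives continuity at accumulation points.\<close>

lemma continuous_vanishing_on_derived:
  assumes "countable (isolated_points :: 'a set)"
  obtains \<theta> :: "'a \<Rightarrow> real" where "continuous_on UNIV \<theta>" "\<And>x. 0 \<le> \<theta> x" "\<And>x. \<theta> x \<le> 1"
    "\<And>x. \<theta> x = 0 \<longleftrightarrow> x \<notin> isolated_points"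
proof -
  define r :: "'a \<Rightarrow> nat" where "r = to_nat_on isolated_points"
  have inj: "inj_on r isolated_points" unfolding r_def using assms by (rule inj_on_to_nat_on)
  define \<theta> where "\<theta> x = (if x \<in> isolated_points then 1 / (1 + real (r x)) else 0)" for x
  have "isCont \<theta> x" for x
  proof (cases "x \<in> isolated_points")
    case True
    then have "at x = bot" by (simp add: isolated_points_def at_eq_bot_iff)
    then show ?thesis by (simp add: isCont_def)
  next
    case False
    show ?thesis unfolding isCont_def
    proof (rule tendstoI)
      fix d :: real assume "0 < d"
      define A where "A = {a \<in> isolated_points. d \<le> \<theta> a}"
      have "finite A"
      proof (rule finite_imageD)
        have "r a \<le> nat \<lceil>1 / d\<rceil>" if "a \<in> A" for a
        proof -
          have "d * (1 + real (r a)) \<le> 1" using that by (auto simp: A_def \<theta>_def field_simps)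
          then have "real (r a) \<le> 1 / d" using \<open>0 < d\<close> by (simp add: field_simps)
          then show ?thesis by linarith
        qed
        then have "r ` A \<subseteq> {..nat \<lceil>1 / d\<rceil>}" by blast
        then show "finite (r ` A)" by (rule finite_subset) simp
        show "inj_on r A" using inj by (rule inj_on_subset) (auto simp: A_def)
      qed
      then have "open (- A)" by (simp add: finite_imp_closed open_Compl)
      moreover have "x \<in> - A" using False by (simp add: A_def)
      ultimately have "\<forall>\<^sub>F y in at x. y \<in> - A" by (rule eventually_at_in_open')
      then show "\<forall>\<^sub>F y in at x. dist (\<theta> y) (\<theta> x) < d"
        by eventually_elim (use False \<open>0 < d\<close> in \<open>auto simp: A_def \<theta>_def\<close>)
    qed
  qed
  then have "continuous_on UNIV \<theta>" by (simp add: continuous_at_imp_continuous_on)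
  moreover have "0 \<le> \<theta> x" "\<theta> x \<le> 1" "\<theta> x = 0 \<longleftrightarrow> x \<notin> isolated_points" for x
    by (auto simp: \<theta>_def field_simps)
  ultimately show ?thesis by (rule that)
qed

end

section \<open>Transfer to bounded continuous functions\<close>

lemma unit_functions_Bcontfun:
  assumes "f \<in> unit_functions"
  shows "apply_bcontfun (Bcontfun f) = f" "Bcontfun f \<in> unit_ball_CK"
proof -
  have "f \<in> bcontfun" using assms bcontfun_normI[of f 1] by (auto simp: unit_functions_def)
  then show *: "apply_bcontfun (Bcontfun f) = f" by (rule Bcontfun_inverse)
  then have "norm (Bcontfun f) \<le> 1" using assms by (intro norm_bound) (simp add: unit_functions_def)
  then show "Bcontfun f \<in> unit_ball_CK" by simp
qed

lemma unit_ball_apply_bcontfun: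
  assumes "f \<in> unit_ball_CK"
  shows "apply_bcontfun f \<in> unit_functions"
  using assms norm_bounded[of f] by (auto simp: unit_functions_def intro: order_trans)

theorem theorem5p1:
  fixes F :: "('a::t2_space \<Rightarrow>\<^sub>C real) \<Rightarrow> ('a \<Rightarrow>\<^sub>C real)"
  assumes K_compact: "compact (UNIV :: 'a set)"
    and K_zero_dim: "zero_dimensional_space TYPE('a)"
    and isolated_dense: "closure {x::'a. x isolated_in UNIV} = UNIV"
    and K'_Gdelta: "gdelta_in (euclidean :: 'a topology) {x. x islimpt (UNIV :: 'a set)}"
    and F_bij: "bij_betw F unit_ball_CK unit_ball_CK"
    and F_nonexp: "\<forall>f\<in>unit_ball_CK. \<forall>g\<in>unit_ball_CK. dist (F f) (F g) \<le> dist f g"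
    and extra: "property_star F \<or>
      (\<exists>c > 1/2. \<forall>a (\<omega>::real) g. a isolated_in (UNIV :: 'a set) \<and> \<omega> \<in> {-1, 1} \<and>
          (\<forall>x. apply_bcontfun g x = \<omega> * indicator {a} x) \<longrightarrow> c \<le> norm (F g))"
  shows "\<forall>f\<in>unit_ball_CK. \<forall>g\<in>unit_ball_CK. dist (F f) (F g) = dist f g"
proof -
  define H where "H = apply_bcontfun \<circ> (F \<circ> Bcontfun)"
  have H_apply: "H (apply_bcontfun f) = apply_bcontfun (F f)" for f
    by (simp add: H_def apply_bcontfun_inverse)
  have "bij_betw (Bcontfun :: ('a \<Rightarrow> real) \<Rightarrow> _) unit_functions unit_ball_CK"
    by (rule bij_betw_byWitness[where f' = apply_bcontfun])
      (use unit_functions_Bcontfun unit_ball_apply_bcontfun apply_bcontfun_inverse in blast)+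
  moreover have "bij_betw (apply_bcontfun :: _ \<Rightarrow> 'a \<Rightarrow> real) unit_ball_CK unit_functions"
    by (rule bij_betw_byWitness[where f' = Bcontfun])
      (use unit_functions_Bcontfun unit_ball_apply_bcontfun apply_bcontfun_inverse in blast)+
  ultimately have H_bij: "bij_betw H unit_functions unit_functions"
    unfolding H_def using F_bij by (blast intro: bij_betw_trans)
  interpret nonexpansive_ball_bijection "TYPE('a)" H
  proof unfold_locales
    fix U :: "'a set" and x assume "open U" "x \<in> U"
    then show "\<exists>V. open V \<and> closed V \<and> x \<in> V \<and> V \<subseteq> U"
      using K_zero_dim by (simp add: zero_dimensional_space_def)
  next
    fix f g :: "'a \<Rightarrow> real" and d x
    assume fg: "f \<in> unit_functions" "g \<in> unit_functions" "\<And>y. \<bar>f y - g y\<bar> \<le> d"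
    have "\<bar>H f x - H g x\<bar> \<le> dist (F (Bcontfun f)) (F (Bcontfun g))"
      using dist_bounded[of "F (Bcontfun f)" x "F (Bcontfun g)"] by (simp add: H_def dist_real_def)
    also have "\<dots> \<le> dist (Bcontfun f) (Bcontfun g)"
      using F_nonexp fg unit_functions_Bcontfun(2) by blast
    also have "\<dots> \<le> d"
      using fg by (intro dist_bound) (simp add: unit_functions_Bcontfun dist_real_def)
    finally show "\<bar>H f x - H g x\<bar> \<le> d" .
  qed (use K_compact isolated_dense H_bij in \<open>auto simp: isolated_points_eq\<close>)
  obtain \<theta> :: "'a \<Rightarrow> real" where \<theta>: "continuous_on UNIV \<theta>" "\<And>x. 0 \<le> \<theta> x" "\<And>x. \<theta> x \<le> 1"
    "\<And>x. \<theta> x = 0 \<longleftrightarrow> x \<notin> isolated_points"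
    using continuous_vanishing_on_derived countable_isolated K'_Gdelta
    unfolding limit_points_eq by metis
  have "inj \<sigma>"
    using extra
  proof
    assume star: "property_star F"
    show ?thesis
    proof (rule inj_\<sigma>_if_star)
      fix u v z :: 'a and w :: real assume "u \<noteq> v" "w \<in> {-1, 1}"
      then obtain f W where f: "f \<in> unit_ball_CK" "sgn (apply_bcontfun f u * apply_bcontfun f v) = w"
        and W: "open W" "z \<in> W" "\<forall>x\<in>W. \<bar>apply_bcontfun (F f) x\<bar> = 1"
        using star unfolding property_star_def by metis
      show "\<exists>f\<in>unit_functions. sgn (f u * f v) = w \<and> (\<exists>W. open W \<and> z \<in> W \<and> (\<forall>x\<in>W. \<bar>H f x\<bar> = 1))"
        using f W unit_ball_apply_bcontfun[OF f(1)] H_apply[of f]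
        by (intro bexI[of _ "apply_bcontfun f"]) auto
    qed
  next
    assume "\<exists>c > 1/2. \<forall>a (\<omega>::real) g. a isolated_in (UNIV :: 'a set) \<and> \<omega> \<in> {-1, 1} \<and>
          (\<forall>x. apply_bcontfun g x = \<omega> * indicator {a} x) \<longrightarrow> c \<le> norm (F g)"
    then obtain c where c: "1/2 < c"
      and norm: "\<And>a \<omega> g. a isolated_in (UNIV :: 'a set) \<Longrightarrow> \<omega> \<in> {-1, 1::real} \<Longrightarrow>
          (\<forall>x. apply_bcontfun g x = \<omega> * indicator {a} x) \<Longrightarrow> c \<le> norm (F g)" by blast
    show ?thesis
    proof (rule inj_\<sigma>_if_large_spikes[OF c])
      fix a b :: 'a and w t :: real
      assume a: "a \<in> isolated_points" and w: "w \<in> {-1, 1}" and image: "H (spike a w) = spike b t"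
      have "spike a w \<in> unit_functions" using a w by (intro spike_in_unit_functions) auto
      then have "c \<le> norm (F (Bcontfun (spike a w)))"
        using a w
        by (intro norm[of a w])
          (auto simp: isolated_points_eq unit_functions_Bcontfun(1) spike_def)
      also have "\<dots> \<le> \<bar>t\<bar>"
      proof (rule norm_bound)
        fix x
        show "norm (apply_bcontfun (F (Bcontfun (spike a w))) x) \<le> \<bar>t\<bar>"
          using fun_cong[OF image, of x] by (simp add: H_def spike_def split: if_splits)
      qed
      finally show "c \<le> \<bar>t\<bar>" .
    qed
  qed
  note formula = F_formula[OF this \<theta>]
  show ?thesis
  proof (intro ballI antisym)
    fix f g :: "'a \<Rightarrow>\<^sub>C real" assume fg: "f \<in> unit_ball_CK" "g \<in> unit_ball_CK"
    show "dist (F f) (F g) \<le> dist f g" using F_nonexp fg by blast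
    \<comment> \<open>Up to the sign \<open>\<epsilon> x\<close>, values of \<open>f\<close> and
      \<open>g\<close> at \<open>x\<close> are those of their images at
      \<open>\<sigma> x\<close>.\<close>
    show "dist f g \<le> dist (F f) (F g)"
    proof (rule dist_bound)
      fix x
      have "dist (apply_bcontfun f x) (apply_bcontfun g x)
          = dist (apply_bcontfun (F f) (\<sigma> x)) (apply_bcontfun (F g) (\<sigma> x))"
        using formula[OF unit_ball_apply_bcontfun[OF fg(1)], of x]
          formula[OF unit_ball_apply_bcontfun[OF fg(2)], of x] \<epsilon>_cases[of x]
        by (auto simp: H_apply dist_real_def)
      also have "\<dots> \<le> dist (F f) (F g)" by (rule dist_bounded)
      finally show "dist (apply_bcontfun f x) (apply_bcontfun g x) \<le> dist (F f) (F g)" .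
    qed
  qed
qed

end
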